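(* Let $r\ge 2$ and $t\ge 3$ be integers, and let $K_r^t$ be the complete $t$-partite graph in which every one of the $t$ partite sets has exactly $r$ vertices. Then $rx_3(K_r^t)=3$.
   Context: All graphs are finite, simple and undirected. Edge-colorings are arbitrary maps from $E(G)$ to a finite set of colors (adjacent edges may receive the same color). A tree $T$ that is a subgraph of an edge-colored graph $G$ is a rainbow tree if no two edges of $T$ have the same color. For $S\subseteq V(G)$, a rainbow $S$-tree is a rainbow tree in $G$ whose vertex set contains $S$ (it may contain other vertices). For a connected graph $G$ of order at least $3$, $rx_3(G)$ (the $3$-rainbow index) is the minimum number of colors in an edge-coloring of $G$ such that for every $3$-element subset $S$ of $V(G)$ there is a rainbow $S$-tree. *)

theory Defs
  imports Complex_Main "HOL-Library.Disjoint_Sets"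
begin

text \<open>A graph is given by its vertex set \<open>V\<close> and its edge set \<open>E\<close>; edges are two-element sets.\<close>

definition simple_graph :: "'a set \<Rightarrow> 'a set set \<Rightarrow> bool" where
  "simple_graph V E \<longleftrightarrow> finite V \<and> (\<forall>e\<in>E. e \<subseteq> V \<and> card e = 2)"

definition graph_connected :: "'a set \<Rightarrow> 'a set set \<Rightarrow> bool" where
  "graph_connected V E \<longleftrightarrow> V \<noteq> {} \<and> (\<forall>u\<in>V. \<forall>v\<in>V. (u, v) \<in> {(x, y). {x, y} \<in> E}\<^sup>*)"

definition is_cycle :: "'a set set \<Rightarrow> 'a list \<Rightarrow> bool" where
  "is_cycle E xs \<longleftrightarrow> length xs \<ge> 3 \<and> distinct xs \<and>
     (\<forall>i<length xs. {xs ! i, xs ! (Suc i mod length xs)} \<in> E)"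

definition is_tree :: "'a set \<Rightarrow> 'a set set \<Rightarrow> bool" where
  "is_tree V E \<longleftrightarrow> simple_graph V E \<and> graph_connected V E \<and> \<not> (\<exists>xs. is_cycle E xs)"

definition rainbow_tree ::
  "'a set \<Rightarrow> 'a set set \<Rightarrow> ('a set \<Rightarrow> 'c) \<Rightarrow> 'a set \<Rightarrow> 'a set set \<Rightarrow> bool" where
  "rainbow_tree V E c W F \<longleftrightarrow> W \<subseteq> V \<and> F \<subseteq> E \<and> is_tree W F \<and> inj_on c F"

definition rainbow_S_tree ::
  "'a set \<Rightarrow> 'a set set \<Rightarrow> ('a set \<Rightarrow> 'c) \<Rightarrow> 'a set \<Rightarrow> 'a set \<Rightarrow> 'a set set \<Rightarrow> bool" where
  "rainbow_S_tree V E c S W F \<longleftrightarrow> rainbow_tree V E c W F \<and> S \<subseteq> W"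

text \<open>The 3-rainbow index. The colors are \<open>0, \<dots>, k - 1\<close>; adjacent edges may share a color.
  The value is meaningful only for connected graphs of order at least 3.\<close>

definition rx3 :: "'a set \<Rightarrow> 'a set set \<Rightarrow> nat" where
  "rx3 V E = (LEAST k. \<exists>c :: 'a set \<Rightarrow> nat. c ` E \<subseteq> {..<k} \<and>
     (\<forall>S. S \<subseteq> V \<and> card S = 3 \<longrightarrow> (\<exists>W F. rainbow_S_tree V E c S W F)))"

text \<open>\<open>P\<close> is the set of partite sets, all of them nonempty.\<close>

definition complete_multipartite :: "'a set \<Rightarrow> 'a set set \<Rightarrow> 'a set set \<Rightarrow> bool" where
  "complete_multipartite V E P \<longleftrightarrow> finite V \<and> partition_on V P \<and>
     E = {{u, v} | u v. \<exists>X\<in>P. \<exists>Y\<in>P. X \<noteq> Y \<and> u \<in> X \<and> v \<in> Y}"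

lemma complete_multipartite_simple_graph:
  assumes "complete_multipartite V E P"
  shows "simple_graph V E"
proof -
  have "finite V" and P: "partition_on V P"
    and E: "E = {{u, v} | u v. \<exists>X\<in>P. \<exists>Y\<in>P. X \<noteq> Y \<and> u \<in> X \<and> v \<in> Y}"
    using assms by (auto simp: complete_multipartite_def)
  moreover have "e \<subseteq> V \<and> card e = 2" if eE: "e \<in> E" for e
  proof -
    obtain u v X Y where e: "e = {u, v}" and XY: "X \<in> P" "Y \<in> P" "X \<noteq> Y" "u \<in> X" "v \<in> Y"
      using eE E by blast
    have "X \<inter> Y = {}"
      using P XY by (auto simp: partition_on_def disjoint_def)
    then have "u \<noteq> v"
      using XY by auto
    moreover have "u \<in> V" "v \<in> V"
      using P XY by (auto simp: partition_on_def)
    ultimately show ?thesis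
      using e by simp
  qed
  ultimately show ?thesis
    by (simp add: simple_graph_def)
qed

end

theory Submission
  imports Defs "HOL-Library.Product_Lexorder"
begin

text \<open>
  Upper bound. Place the vertices on a grid: \<open>p v\<close> is the number of the partite set of \<open>v\<close> and
  \<open>i v\<close> is the position of \<open>v\<close> in it. For \<open>p u < p v\<close>, the edge \<open>{u, v}\<close> gets color 0, 1 or 2
  according to whether \<open>i u\<close> is smaller than, equal to or larger than \<open>i v\<close>. Three vertices of one
  part are then joined by a star whose center has the position of the middle one, since the center
  sees one vertex below it, one level with it and one above it. All other triples are joined by a
  rainbow path with two edges or, if the edges among them have a single color, by a rainbow path
  with one additional vertex; the position of that vertex is copied from one of the three in all
  cases but one, the triples at equal positions in three parts. There the middle one of the three
  parts provides it: any other vertex of that part sees the two outer parts from opposite sides.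

  Lower bound. A connected graph on \<open>n\<close> vertices has at least \<open>n - 1\<close> edges, so with two colors
  a rainbow tree has at most three vertices, and every triple must itself contain two edges of
  different colors. Hence two vertices of the same part receive different colors from every vertex
  outside that part. Take \<open>a \<noteq> a'\<close> in one part, and in two further parts vertices \<open>b\<close> and \<open>d\<close>
  joined to \<open>a\<close> by color 0, so that color 1 joins them to \<open>a'\<close>. Whatever the color of
  \<open>{b, d}\<close> is, one of the triangles on \<open>a, b, d\<close> and \<open>a', b, d\<close> is monochromatic.
\<close>

section \<open>Growing rainbow trees\<close>

lemma is_tree_singleton: "is_tree {v} {}"
proof -
  have "\<not> is_cycle {} xs" for xs :: "'a list"
    by (cases xs) (auto simp: is_cycle_def)
  then show ?thesis
    by (auto simp: is_tree_def simple_graph_def graph_connected_def)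
qed

text \<open>The new vertex \<open>y\<close> lies on no cycle, because both neighbors of \<open>y\<close> on a cycle would have to
  be \<open>x\<close>.\<close>

lemma is_tree_attach_leaf:
  assumes tree: "is_tree W F" and x: "x \<in> W" and y: "y \<notin> W"
  shows "is_tree (insert y W) (insert {x, y} F)"
proof -
  let ?F = "insert {x, y} F"
  let ?R = "{(u, v). {u, v} \<in> F}" and ?R' = "{(u, v). {u, v} \<in> ?F}"
  have sg: "simple_graph W F" and con: "graph_connected W F" and acyclic: "\<not> is_cycle F xs" for xs
    using tree by (auto simp: is_tree_def)
  have "x \<noteq> y" using x y by auto
  then have "simple_graph (insert y W) ?F"
    using sg x by (auto simp: simple_graph_def)
  moreover have "graph_connected (insert y W) ?F"
  proof -
    have old: "(u, v) \<in> ?R'\<^sup>*" if "u \<in> W" "v \<in> W" for u v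
    proof -
      have "(u, v) \<in> ?R\<^sup>*" using con that by (simp add: graph_connected_def)
      moreover have "?R\<^sup>* \<subseteq> ?R'\<^sup>*" by (rule rtrancl_mono) auto
      ultimately show ?thesis by blast
    qed
    have xy: "(x, y) \<in> ?R'" "(y, x) \<in> ?R'" by (auto simp: insert_commute)
    have "(u, y) \<in> ?R'\<^sup>*" "(y, u) \<in> ?R'\<^sup>*" if "u \<in> W" for u
      using old[OF that x] old[OF x that] xy
      by (meson rtrancl.rtrancl_into_rtrancl converse_rtrancl_into_rtrancl)+
    then show ?thesis
      using old by (auto simp: graph_connected_def)
  qed
  moreover have "\<not> is_cycle ?F xs" for xs
  proof
    assume cyc: "is_cycle ?F xs"
    let ?n = "length xs"
    have n: "?n \<ge> 3" and dist: "distinct xs"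
      and edge: "\<And>k. k < ?n \<Longrightarrow> {xs ! k, xs ! (Suc k mod ?n)} \<in> ?F"
      using cyc by (auto simp: is_cycle_def)
    have at_y: "e = {x, y}" if "e \<in> ?F" "y \<in> e" for e
      using that sg y by (auto simp: simple_graph_def)
    show False
    proof (cases "y \<in> set xs")
      case True
      then obtain j where j: "j < ?n" "xs ! j = y" by (auto simp: in_set_conv_nth)
      let ?s = "Suc j mod ?n"
      let ?q = "if j = 0 then ?n - 1 else j - 1"
      have q: "?q < ?n" "Suc ?q mod ?n = j" using j n by auto
      have s: "?s < ?n" using n by (intro mod_less_divisor) linarith
      have "?q \<noteq> ?s"
        using j n by (cases "Suc j = ?n") auto
      then have ne: "xs ! ?q \<noteq> xs ! ?s"
        using dist q s by (simp add: nth_eq_iff_index_eq)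
      have "{xs ! j, xs ! ?s} = {x, y}"
        using edge[OF j(1)] j(2) by (intro at_y) auto
      moreover have "{xs ! ?q, xs ! j} = {x, y}"
        using edge[OF q(1)] j(2) q(2) by (intro at_y) auto
      ultimately show False
        using ne j(2) \<open>x \<noteq> y\<close> by (auto simp: doubleton_eq_iff)
    next
      case False
      have "{xs ! k, xs ! (Suc k mod ?n)} \<in> F" if k: "k < ?n" for k
      proof -
        have "Suc k mod ?n < ?n" using n by (intro mod_less_divisor) linarith
        then have "y \<notin> {xs ! k, xs ! (Suc k mod ?n)}"
          using False k nth_mem by fastforce
        then show ?thesis using edge[OF k] by auto
      qed
      then have "is_cycle F xs"
        using n dist by (simp add: is_cycle_def)
      then show False using acyclic by blast
    qed
  qed
  ultimately show ?thesis by (simp add: is_tree_def)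
qed

lemma rainbow_tree_singleton: "v \<in> V \<Longrightarrow> rainbow_tree V E c {v} {}"
  by (simp add: rainbow_tree_def is_tree_singleton)

lemma rainbow_tree_attach_leaf:
  assumes "rainbow_tree V E c W F" "x \<in> W" "y \<in> V" "y \<notin> W" "{x, y} \<in> E" "c {x, y} \<notin> c ` F"
  shows "rainbow_tree V E c (insert y W) (insert {x, y} F)"
  using assms is_tree_attach_leaf[of W F x y] by (auto simp: rainbow_tree_def)

lemma rainbow_path_3:
  assumes "simple_graph V E" "distinct [x, y, z]"
    and "{x, y} \<in> E" "{y, z} \<in> E" "c {x, y} \<noteq> c {y, z}"
  shows "rainbow_tree V E c {z, y, x} {{y, z}, {x, y}}"
proof -
  have V: "x \<in> V" "y \<in> V" "z \<in> V" using assms by (auto simp: simple_graph_def)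
  have "rainbow_tree V E c {y, x} {{x, y}}"
    by (rule rainbow_tree_attach_leaf[OF rainbow_tree_singleton]) (use assms V in auto)
  then show ?thesis
    by (rule rainbow_tree_attach_leaf) (use assms V in auto)
qed

lemma rainbow_S_tree_path_3:
  assumes "simple_graph V E" "distinct [x, y, z]"
    and "{x, y} \<in> E" "{y, z} \<in> E" "c {x, y} \<noteq> c {y, z}"
  shows "\<exists>W F. rainbow_S_tree V E c {x, y, z} W F"
  using rainbow_path_3[OF assms] unfolding rainbow_S_tree_def by blast

lemma rainbow_S_tree_path_4:
  assumes "simple_graph V E" "distinct [x, w, y, z]"
    and "{x, w} \<in> E" "{w, y} \<in> E" "{y, z} \<in> E"
    and "distinct [c {x, w}, c {w, y}, c {y, z}]"
  shows "\<exists>W F. rainbow_S_tree V E c {x, y, z} W F"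
proof -
  have "rainbow_tree V E c {y, w, x} {{w, y}, {x, w}}"
    by (rule rainbow_path_3) (use assms in auto)
  moreover have z: "z \<in> V" using assms by (auto simp: simple_graph_def)
  ultimately have "rainbow_tree V E c {z, y, w, x} {{y, z}, {w, y}, {x, w}}"
    by (intro rainbow_tree_attach_leaf[where W = "{y, w, x}"]) (use assms z in auto)
  then show ?thesis unfolding rainbow_S_tree_def by blast
qed

lemma rainbow_S_tree_star:
  assumes "simple_graph V E" "distinct [x, y, z, w]"
    and "{x, w} \<in> E" "{w, y} \<in> E" "{w, z} \<in> E"
    and "distinct [c {x, w}, c {w, y}, c {w, z}]"
  shows "\<exists>W F. rainbow_S_tree V E c {x, y, z} W F"
proof -
  have "rainbow_tree V E c {y, w, x} {{w, y}, {x, w}}"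
    by (rule rainbow_path_3) (use assms in auto)
  moreover have z: "z \<in> V" using assms by (auto simp: simple_graph_def)
  ultimately have "rainbow_tree V E c {z, y, w, x} {{w, z}, {w, y}, {x, w}}"
    by (intro rainbow_tree_attach_leaf[where W = "{y, w, x}"]) (use assms z in auto)
  then show ?thesis unfolding rainbow_S_tree_def by blast
qed

section \<open>Coloring by comparing positions\<close>

text \<open>Edges are unordered, so the numbers of the parts decide which end is compared with which. The
  last color is also the default value outside the edge set.\<close>

definition position_coloring :: "('a \<Rightarrow> nat) \<Rightarrow> ('a \<Rightarrow> nat) \<Rightarrow> 'a set \<Rightarrow> nat" where
  "position_coloring p i e =
     (if \<exists>u v. e = {u, v} \<and> p u < p v \<and> i u < i v then 0
      else if \<exists>u v. e = {u, v} \<and> p u < p v \<and> i u = i v then 1 else 2)"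

lemma position_coloring_less:
  "p u < p v \<Longrightarrow> position_coloring p i {u, v} = (if i u < i v then 0 else if i u = i v then 1 else 2)"
  by (auto simp: position_coloring_def doubleton_eq_iff)

lemma position_coloring_greater:
  "p v < p u \<Longrightarrow> position_coloring p i {u, v} = (if i v < i u then 0 else if i v = i u then 1 else 2)"
  using position_coloring_less[of p v u i] by (simp add: insert_commute)

lemmas position_coloring_simps = position_coloring_less position_coloring_greater

lemma card_3_sorted:
  fixes f :: "'a \<Rightarrow> 'b :: linorder"
  assumes "card S = 3" and "inj_on f S"
  obtains x y z where "S = {x, y, z}" "f x < f y" "f y < f z"
proof -
  obtain a b d where S: "S = {a, b, d}" and ne: "a \<noteq> b" "b \<noteq> d" "a \<noteq> d"
    using assms(1) by (auto simp: card_3_iff)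
  have perms: "S = {a, d, b}" "S = {b, a, d}" "S = {b, d, a}" "S = {d, a, b}" "S = {d, b, a}"
    using S by auto
  have "f a \<noteq> f b" "f b \<noteq> f d" "f a \<noteq> f d"
    using assms(2) S ne by (auto dest: inj_onD)
  then have "f a < f b \<or> f b < f a" "f b < f d \<or> f d < f b" "f a < f d \<or> f d < f a"
    by (simp_all add: neq_iff)
  then consider "f a < f b" "f b < f d" | "f a < f d" "f d < f b" | "f b < f a" "f a < f d"
    | "f b < f d" "f d < f a" | "f d < f a" "f a < f b" | "f d < f b" "f b < f a"
    by blast
  then show thesis
  proof cases
    case 1 then show ?thesis using that S by blast
  next
    case 2 then show ?thesis using that perms(1) by blast
  next
    case 3 then show ?thesis using that perms(2) by blast
  next
    case 4 then show ?thesis using that perms(3) by blast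
  next
    case 5 then show ?thesis using that perms(4) by blast
  next
    case 6 then show ?thesis using that perms(5) by blast
  qed
qed

locale grid_multipartite =
  fixes V :: "'a set" and E :: "'a set set" and p i :: "'a \<Rightarrow> nat" and r t :: nat
  assumes coords: "bij_betw (\<lambda>v. (p v, i v)) V ({..<t} \<times> {..<r})"
    and edge_iff: "{u, v} \<in> E \<longleftrightarrow> u \<in> V \<and> v \<in> V \<and> p u \<noteq> p v"
    and simple: "simple_graph V E"
    and two_parts: "t \<ge> 2" and two_positions: "r \<ge> 2"
begin

abbreviation "col \<equiv> position_coloring p i"
abbreviation "joined S \<equiv> \<exists>W F. rainbow_S_tree V E col S W F"

lemma vertex_at:
  assumes "q < t" "m < r"
  obtains w where "w \<in> V" "p w = q" "i w = m"
proof -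
  have "(q, m) \<in> (\<lambda>v. (p v, i v)) ` V"
    using coords assms by (auto simp: bij_betw_def)
  then show thesis using that by auto
qed

lemma coords_bounds: "v \<in> V \<Longrightarrow> p v < t" "v \<in> V \<Longrightarrow> i v < r"
  using coords by (auto simp: bij_betw_def)

lemma joined_one_part:
  assumes V: "x \<in> V" "y \<in> V" "z \<in> V" and "p x = p y" "p y = p z" "i x < i y" "i y < i z"
  shows "joined {x, y, z}"
proof -
  define q where "q = (if p y = 0 then 1 else 0 :: nat)"
  have q: "q < t" "q \<noteq> p y" using two_parts by (auto simp: q_def)
  obtain w where "w \<in> V" "p w = q" "i w = i y"
    using vertex_at[OF q(1) coords_bounds(2)[OF V(2)]] .
  with q assms show ?thesis
    by (intro rainbow_S_tree_star[OF simple, of x y z w]; cases "p y < q")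
       (auto simp: edge_iff position_coloring_simps)
qed

text \<open>If \<open>z\<close> sees \<open>x\<close> and \<open>y\<close> in the same color, then their positions lie on one side of that of
  \<open>z\<close>. The vertex \<open>w\<close> in the part of \<open>z\<close> that is level with the farther one of \<open>x\<close> and \<open>y\<close> makes
  \<open>x, w, y, z\<close> a rainbow path. For \<open>i x < i y < i z\<close>, it is level with \<open>x\<close> and below \<open>y\<close>, whereas
  \<open>z\<close> is above \<open>y\<close>; for \<open>i z < i x < i y\<close>, it is level with \<open>y\<close> and above \<open>x\<close>, whereas \<open>z\<close> is
  below \<open>y\<close>. All three edges join the same two parts, so these three comparisons are three colors.\<close>

lemma joined_two_parts:
  assumes V: "x \<in> V" "y \<in> V" "z \<in> V" and p: "p x = p y" "p y \<noteq> p z" and i: "i x < i y"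
  shows "joined {x, y, z}"
proof (cases "col {x, z} = col {z, y}")
  case False
  have "joined {x, z, y}"
    by (rule rainbow_S_tree_path_3[OF simple]) (use V p i False in \<open>auto simp: edge_iff\<close>)
  then show ?thesis by (simp add: insert_commute)
next
  case True
  then consider "i y < i z" | "i z < i x"
    using p i
    by (cases "p y < p z") (auto simp: position_coloring_simps split: if_splits)
  then obtain m where m: "m < r" "m \<noteq> i z" "i y < i z \<and> m = i x \<or> i z < i x \<and> m = i y"
    using V i coords_bounds(2) by (metis less_irrefl less_trans)
  obtain w where w: "w \<in> V" "p w = p z" "i w = m"
    using vertex_at[OF coords_bounds(1)[OF V(3)] m(1)] .
  show ?thesis
  proof (rule rainbow_S_tree_path_4[OF simple])
    show "distinct [x, w, y, z]" using w m p i by auto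
    show "{x, w} \<in> E" "{w, y} \<in> E" "{y, z} \<in> E" using w p V by (auto simp: edge_iff)
    show "distinct [col {x, w}, col {w, y}, col {y, z}]"
    proof (cases "p y < p z")
      case True
      then show ?thesis using w m p i by (elim disjE) (simp_all add: position_coloring_simps)
    next
      case False
      then have "p z < p y" using p by simp
      then show ?thesis using w m p i by (elim disjE) (simp_all add: position_coloring_simps)
    qed
  qed
qed

text \<open>Only monochromatic triangles need an additional vertex \<open>w\<close>. In color 0 or 2 the position of \<open>y\<close>
  lies strictly between the other two, so \<open>y\<close> sees \<open>z\<close> and the vertex of the part of \<open>z\<close> level with
  \<open>x\<close> on opposite sides. In color 1 all positions agree; a vertex \<open>w\<close> of the part of \<open>y\<close> at another
  position then compares with \<open>x\<close> as it does with \<open>z\<close>, but it is the later end of \<open>{x, w}\<close> and the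
  earlier end of \<open>{w, z}\<close>, which exchanges the colors 0 and 2.\<close>

lemma joined_three_parts:
  assumes V: "x \<in> V" "y \<in> V" "z \<in> V" and p: "p x < p y" "p y < p z"
  shows "joined {x, y, z}"
proof -
  have xz: "p x < p z" using p by simp
  have ne: "x \<noteq> y" "y \<noteq> z" "x \<noteq> z" using p by auto
  consider (mixed) "col {x, y} \<noteq> col {y, z}" | (mixed') "col {y, z} \<noteq> col {z, x}"
    | (monotone) "i x < i y \<and> i y < i z \<or> i z < i y \<and> i y < i x" | (level) "i x = i y" "i y = i z"
    using p xz by (fastforce simp: position_coloring_simps split: if_splits)
  then show ?thesis
  proof cases
    case mixed
    then show ?thesis
      by (intro rainbow_S_tree_path_3[OF simple]) (use V p in \<open>auto simp: edge_iff\<close>)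
  next
    case mixed'
    have "joined {y, z, x}"
      by (rule rainbow_S_tree_path_3[OF simple]) (use V p mixed' in \<open>auto simp: edge_iff\<close>)
    then show ?thesis by (simp add: insert_commute)
  next
    case monotone
    obtain w where "w \<in> V" "p w = p z" "i w = i x"
      using vertex_at[OF coords_bounds(1)[OF V(3)] coords_bounds(2)[OF V(1)]] .
    with monotone p xz ne V show ?thesis
      by (intro rainbow_S_tree_path_4[OF simple, of x w y z])
         (auto simp: edge_iff position_coloring_simps)
  next
    case level
    define m where "m = (if i y = 0 then 1 else 0 :: nat)"
    have m: "m < r" "m \<noteq> i y" using two_positions by (auto simp: m_def)
    obtain w where "w \<in> V" "p w = p y" "i w = m"
      using vertex_at[OF coords_bounds(1)[OF V(2)] m(1)] .
    with m level p xz ne V have "joined {x, z, y}"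
      by (intro rainbow_S_tree_path_4[OF simple, of x w z y])
         (auto simp: edge_iff position_coloring_simps)
    then show ?thesis by (simp add: insert_commute)
  qed
qed

lemma joined_triple:
  assumes S: "S \<subseteq> V" "card S = 3"
  shows "joined S"
proof -
  let ?f = "\<lambda>v. (p v, i v)"
  have "inj_on ?f S" using coords S(1) by (auto simp: bij_betw_def intro: inj_on_subset)
  \<comment> \<open>The order on pairs is lexicographic, so there are four ways to distribute \<open>x, y, z\<close> over parts.\<close>
  then obtain x y z where xyz: "S = {x, y, z}" "?f x < ?f y" "?f y < ?f z"
    by (rule card_3_sorted[OF S(2)])
  have V: "x \<in> V" "y \<in> V" "z \<in> V" using xyz S(1) by auto
  consider "p x = p y" "p y = p z" "i x < i y" "i y < i z"
    | "p x = p y" "p y < p z" "i x < i y" | "p x < p y" "p y = p z" "i y < i z"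
    | "p x < p y" "p y < p z"
    using xyz(2,3) by (auto simp: le_less)
  then show ?thesis
    unfolding xyz(1)
  proof cases
    case 1
    then show "joined {x, y, z}" using V by (intro joined_one_part)
  next
    case 2
    then show "joined {x, y, z}" using V by (intro joined_two_parts) auto
  next
    case 3
    then have "joined {y, z, x}" using V by (intro joined_two_parts) auto
    then show "joined {x, y, z}" by (simp add: insert_commute)
  next
    case 4
    then show "joined {x, y, z}" using V by (intro joined_three_parts)
  qed
qed

end

lemma partition_coordinates:
  assumes "finite V" and P: "partition_on V P" and "card P = t" and r: "\<forall>X\<in>P. card X = r"
  obtains p i :: "'a \<Rightarrow> nat"
  where "bij_betw (\<lambda>v. (p v, i v)) V ({..<t} \<times> {..<r})"
    and "\<And>X Y u v. X \<in> P \<Longrightarrow> Y \<in> P \<Longrightarrow> u \<in> X \<Longrightarrow> v \<in> Y \<Longrightarrow> p u = p v \<longleftrightarrow> X = Y"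
proof -
  have "finite P" using assms finite_elements by blast
  then obtain h where h: "bij_betw h P {..<t}"
    using ex_bij_betw_finite_nat[of P] assms(3) by (auto simp: atLeast0LessThan)
  have fin: "finite X" if "X \<in> P" for X
    using that P \<open>finite V\<close> by (metis Union_upper finite_subset partition_onD1)
  have "\<forall>X\<in>P. \<exists>g. bij_betw g X {..<r}"
    using ex_bij_betw_finite_nat[OF fin] r by (auto simp: atLeast0LessThan)
  then obtain g where g: "\<And>X. X \<in> P \<Longrightarrow> bij_betw (g X) X {..<r}" by metis
  define part where "part v = (THE X. X \<in> P \<and> v \<in> X)" for v
  have part: "part v = X" if "X \<in> P" "v \<in> X" for v X
    unfolding part_def using that P
    by (intro the_equality) (auto simp: partition_on_def disjoint_def)
  have ex: "\<exists>X\<in>P. v \<in> X" if "v \<in> V" for v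
    using that P by (auto simp: partition_on_def)
  have PV: "v \<in> V" if "v \<in> X" "X \<in> P" for v X
    using that P by (auto simp: partition_on_def)
  let ?p = "\<lambda>v. h (part v)" and ?i = "\<lambda>v. g (part v) v"
  have "inj_on (\<lambda>v. (?p v, ?i v)) V"
  proof (rule inj_onI)
    fix u v assume uv: "u \<in> V" "v \<in> V" "(?p u, ?i u) = (?p v, ?i v)"
    obtain X Y where XY: "X \<in> P" "u \<in> X" "Y \<in> P" "v \<in> Y" using ex uv by metis
    note parts = part[OF XY(1,2)] part[OF XY(3,4)]
    then have "X = Y"
      using uv(3) XY inj_onD[OF bij_betw_imp_inj_on[OF h], of X Y] by simp
    then show "u = v"
      using XY uv(3) parts inj_onD[OF bij_betw_imp_inj_on[OF g[OF XY(1)]], of u v] by simp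
  qed
  moreover have "(\<lambda>v. (?p v, ?i v)) ` V = {..<t} \<times> {..<r}"
  proof (intro equalityI subsetI)
    fix z assume "z \<in> (\<lambda>v. (?p v, ?i v)) ` V"
    then obtain v where v: "v \<in> V" "z = (?p v, ?i v)" by auto
    obtain X where X: "X \<in> P" "v \<in> X" using ex[OF v(1)] by auto
    have "h X \<in> {..<t}" "g X v \<in> {..<r}"
      using X bij_betwE[OF h] bij_betwE[OF g[OF X(1)]] by blast+
    then show "z \<in> {..<t} \<times> {..<r}"
      using part[OF X] v(2) by simp
  next
    fix z assume "z \<in> {..<t} \<times> {..<r}"
    then obtain q m where z: "z = (q, m)" "q < t" "m < r" by auto
    have "q \<in> h ` P" using bij_betw_imp_surj_on[OF h] z(2) by simp
    then obtain X where X: "X \<in> P" "h X = q" by auto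
    have "m \<in> g X ` X" using bij_betw_imp_surj_on[OF g[OF X(1)]] z(3) by simp
    then obtain v where v: "v \<in> X" "g X v = m" by auto
    then show "z \<in> (\<lambda>v. (?p v, ?i v)) ` V"
      using z X PV[OF v(1) X(1)] part[OF X(1) v(1)] by (intro image_eqI[of _ _ v]) simp_all
  qed
  moreover have "?p u = ?p v \<longleftrightarrow> X = Y" if "X \<in> P" "Y \<in> P" "u \<in> X" "v \<in> Y" for X Y u v
    using that part[OF that(1,3)] part[OF that(2,4)]
      inj_on_eq_iff[OF bij_betw_imp_inj_on[OF h], of X Y] by simp
  ultimately show thesis
    unfolding bij_betw_def by (intro that[of ?p ?i]) (simp_all add: bij_betw_def)
qed

lemma complete_multipartite_edge_iff:
  assumes "complete_multipartite V E P" "X \<in> P" "Y \<in> P" "u \<in> X" "v \<in> Y"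
  shows "{u, v} \<in> E \<longleftrightarrow> X \<noteq> Y"
proof -
  have E: "E = {{u, v} | u v. \<exists>X\<in>P. \<exists>Y\<in>P. X \<noteq> Y \<and> u \<in> X \<and> v \<in> Y}"
    and uniq: "\<And>X' Y' w. X' \<in> P \<Longrightarrow> Y' \<in> P \<Longrightarrow> w \<in> X' \<Longrightarrow> w \<in> Y' \<Longrightarrow> X' = Y'"
    using assms(1) by (auto simp: complete_multipartite_def partition_on_def disjoint_def)
  show ?thesis
  proof
    assume "{u, v} \<in> E"
    then obtain u' v' X' Y' where "{u, v} = {u', v'}"
      and XY': "X' \<in> P" "Y' \<in> P" "X' \<noteq> Y'" "u' \<in> X'" "v' \<in> Y'"
      unfolding E by blast
    then have "u = u' \<and> v = v' \<or> u = v' \<and> v = u'" by (simp add: doubleton_eq_iff)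
    then show "X \<noteq> Y" using uniq XY' assms(2-5) by metis
  qed (use assms(2-5) E in blast)
qed

lemma balanced_multipartite_three_colors:
  assumes mp: "complete_multipartite V E P" and "card P = t" "\<forall>X\<in>P. card X = r"
    and "r \<ge> 2" "t \<ge> 2"
  shows "\<exists>c :: 'a set \<Rightarrow> nat. c ` E \<subseteq> {..<3} \<and>
     (\<forall>S. S \<subseteq> V \<and> card S = 3 \<longrightarrow> (\<exists>W F. rainbow_S_tree V E c S W F))"
proof -
  have V: "finite V" "partition_on V P" using mp by (auto simp: complete_multipartite_def)
  obtain p i :: "'a \<Rightarrow> nat" where bij: "bij_betw (\<lambda>v. (p v, i v)) V ({..<t} \<times> {..<r})"
    and p: "\<And>X Y u v. X \<in> P \<Longrightarrow> Y \<in> P \<Longrightarrow> u \<in> X \<Longrightarrow> v \<in> Y \<Longrightarrow> p u = p v \<longleftrightarrow> X = Y"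
    using partition_coordinates[OF V assms(2,3)] by blast
  have sg: "simple_graph V E" using complete_multipartite_simple_graph[OF mp] .
  have edge: "{u, v} \<in> E \<longleftrightarrow> u \<in> V \<and> v \<in> V \<and> p u \<noteq> p v" for u v
  proof (cases "u \<in> V \<and> v \<in> V")
    case True
    then obtain X Y where "X \<in> P" "Y \<in> P" "u \<in> X" "v \<in> Y"
      using V(2) by (auto simp: partition_on_def)
    then show ?thesis
      using True p complete_multipartite_edge_iff[OF mp] by metis
  next
    case False
    then show ?thesis using sg by (auto simp: simple_graph_def)
  qed
  interpret grid_multipartite V E p i r t
    using bij edge sg assms by unfold_locales
  have "position_coloring p i ` E \<subseteq> {..<3}" by (auto simp: position_coloring_def)
  then show ?thesis using joined_triple by blast
qed

section \<open>Two colors do not suffice\<close>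

text \<open>A vertex set that is not yet everything is left by some edge, so it can be enlarged by one
  vertex together with one new edge.\<close>

lemma connected_card_le:
  assumes sg: "simple_graph V E" and con: "graph_connected V E"
  shows "card V \<le> card E + 1"
proof -
  let ?R = "{(x, y). {x, y} \<in> E}"
  have fin: "finite V" and EV: "E \<subseteq> Pow V" using sg by (auto simp: simple_graph_def)
  have finE: "finite E" using finite_subset[OF EV] fin by simp
  have grow: "\<exists>A B. A \<subseteq> V \<and> A \<noteq> {} \<and> card A = Suc n \<and> B \<subseteq> E \<inter> Pow A \<and> card B = n"
    if "n < card V" for n
    using that
  proof (induction n)
    case 0
    obtain v where "v \<in> V" using con by (auto simp: graph_connected_def)
    then show ?case by (intro exI[of _ "{v}"] exI[of _ "{}"]) auto
  next
    case (Suc n)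
    then obtain A B where AB: "A \<subseteq> V" "A \<noteq> {}" "card A = Suc n" "B \<subseteq> E \<inter> Pow A" "card B = n"
      by auto
    have "A \<noteq> V" using AB Suc.prems by auto
    then obtain u v where uv: "u \<in> A" "v \<in> V" "v \<notin> A" using AB by blast
    have "(u, v) \<in> ?R\<^sup>*" using con uv AB by (auto simp: graph_connected_def)
    then have "\<exists>x y. {x, y} \<in> E \<and> x \<in> A \<and> y \<notin> A"
      using uv(1,3) by (induction rule: rtrancl_induct) auto
    then obtain x y where xy: "{x, y} \<in> E" "x \<in> A" "y \<notin> A" by blast
    have "finite A" "finite B" using AB fin finE finite_subset by blast+
    moreover have "{x, y} \<notin> B" using AB xy by auto
    moreover have "y \<in> V" using xy EV by auto
    ultimately show ?case
      using AB xy by (intro exI[of _ "insert y A"] exI[of _ "insert {x, y} B"]) auto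
  qed
  show ?thesis
  proof (cases "card V")
    case (Suc n)
    then obtain B where "B \<subseteq> E" "card B = n" using grow[of n] by auto
    then show ?thesis using Suc card_mono[OF finE] by fastforce
  qed simp
qed

text \<open>With two colors a rainbow tree has at most two edges, so it has no room for a fourth
  vertex.\<close>

lemma two_colored_triple:
  assumes "rainbow_S_tree V E c S W F" "card S = 3" "c ` E \<subseteq> {..<2 :: nat}"
  shows "\<exists>e\<in>E. \<exists>f\<in>E. e \<subseteq> S \<and> f \<subseteq> S \<and> c e \<noteq> c f"
proof -
  have F: "F \<subseteq> E" "inj_on c F" "S \<subseteq> W" and sg: "simple_graph W F" and con: "graph_connected W F"
    using assms(1) by (auto simp: rainbow_S_tree_def rainbow_tree_def is_tree_def)
  have "card F = card (c ` F)" using F(2) by (simp add: card_image)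
  also have "\<dots> \<le> card {..<2 :: nat}" using F(1) assms(3) by (intro card_mono) auto
  finally have F2: "card F \<le> 2" by simp
  have finW: "finite W" using sg by (simp add: simple_graph_def)
  have W: "card W \<le> card F + 1" using connected_card_le[OF sg con] .
  moreover have "3 \<le> card W" using card_mono[OF finW F(3)] assms(2) by simp
  ultimately have "card F = 2" "card W \<le> card S" using F2 assms(2) by auto
  then obtain e f where ef: "F = {e, f}" "e \<noteq> f" by (auto simp: card_2_iff)
  have "W = S" using card_seteq[OF finW F(3)] \<open>card W \<le> card S\<close> by auto
  then show ?thesis
    using ef F sg by (auto simp: simple_graph_def inj_on_def)
qed

lemma card_2_subset_triple:
  assumes "card e = 2" "e \<subseteq> {x, y, z}"
  shows "e = {x, y} \<or> e = {x, z} \<or> e = {y, z}"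
proof -
  obtain u v where uv: "e = {u, v}" "u \<noteq> v" using assms(1) by (auto simp: card_2_iff)
  then have "u \<in> {x, y, z}" "v \<in> {x, y, z}" using assms(2) by auto
  then show ?thesis
    using uv(2) unfolding uv(1) by (elim insertE emptyE) (simp_all add: doubleton_eq_iff)
qed

lemma multipartite_two_colors_insufficient:
  fixes c :: "'a set \<Rightarrow> nat"
  assumes mp: "complete_multipartite V E P" and "card P \<ge> 3" "\<forall>X\<in>P. card X \<ge> 2"
    and colors: "c ` E \<subseteq> {..<2}"
    and trees: "\<And>S. S \<subseteq> V \<Longrightarrow> card S = 3 \<Longrightarrow> \<exists>W F. rainbow_S_tree V E c S W F"
  shows False
proof -
  have PV: "\<And>X v. X \<in> P \<Longrightarrow> v \<in> X \<Longrightarrow> v \<in> V"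
    and disj: "\<And>X Y v. X \<in> P \<Longrightarrow> Y \<in> P \<Longrightarrow> v \<in> X \<Longrightarrow> v \<in> Y \<Longrightarrow> X = Y"
    using mp by (auto simp: complete_multipartite_def partition_on_def disjoint_def)
  have edge: "{u, v} \<in> E \<longleftrightarrow> X \<noteq> Y" if "X \<in> P" "Y \<in> P" "u \<in> X" "v \<in> Y" for u v X Y
    using complete_multipartite_edge_iff[OF mp that] .
  have edge_in_triple: "e = {x, y} \<or> e = {x, z} \<or> e = {y, z}"
    if "e \<in> E" "e \<subseteq> {x, y, z}" for e x y z
    using complete_multipartite_simple_graph[OF mp] that
    by (intro card_2_subset_triple) (auto simp: simple_graph_def)
  have two: "\<exists>e\<in>E. \<exists>f\<in>E. e \<subseteq> {x, y, z} \<and> f \<subseteq> {x, y, z} \<and> c e \<noteq> c f"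
    if "x \<in> V" "y \<in> V" "z \<in> V" "x \<noteq> y" "y \<noteq> z" "x \<noteq> z" for x y z
  proof -
    have "{x, y, z} \<subseteq> V" and card: "card {x, y, z} = 3" using that by auto
    then obtain W F where "rainbow_S_tree V E c {x, y, z} W F" using trees by blast
    then show ?thesis using card colors by (rule two_colored_triple)
  qed
  \<comment> \<open>The triple \<open>{u, u', v}\<close> spans only the two edges at \<open>v\<close>.\<close>
  have split: "c {u, v} \<noteq> c {u', v}"
    if XY: "X \<in> P" "Y \<in> P" "X \<noteq> Y" "u \<in> X" "u' \<in> X" "u \<noteq> u'" "v \<in> Y" for X Y u u' v
  proof -
    have ne: "u \<noteq> v" "u' \<noteq> v" using XY disj by blast+
    obtain e f where ef: "e \<in> E" "f \<in> E" "e \<subseteq> {u, u', v}" "f \<subseteq> {u, u', v}" "c e \<noteq> c f"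
      using two[OF PV PV PV, OF XY(1,4,1,5,2,7,6) ne(2,1)] by blast
    have "{u, u'} \<notin> E" using edge[OF XY(1,1,4,5)] by simp
    then have "g = {u, v} \<or> g = {u', v}" if "g \<in> E" "g \<subseteq> {u, u', v}" for g
      using edge_in_triple[OF that] that(1) by blast
    then show ?thesis using ef by metis
  qed
  have nonmono: "\<not> (c {x, y} = k \<and> c {x, z} = k \<and> c {y, z} = k)"
    if XYZ: "X \<in> P" "Y \<in> P" "Z \<in> P" "X \<noteq> Y" "X \<noteq> Z" "Y \<noteq> Z" "x \<in> X" "y \<in> Y" "z \<in> Z"
    for X Y Z x y z k
  proof -
    have ne: "x \<noteq> y" "y \<noteq> z" "x \<noteq> z" using XYZ disj by blast+
    obtain e f where ef: "e \<in> E" "f \<in> E" "e \<subseteq> {x, y, z}" "f \<subseteq> {x, y, z}" "c e \<noteq> c f"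
      using two[OF PV PV PV, OF XYZ(1,7,2,8,3,9) ne] by blast
    then show ?thesis
      using edge_in_triple[OF ef(1,3)] edge_in_triple[OF ef(2,4)] by metis
  qed
  have color: "c {u, v} = 0 \<or> c {u, v} = 1" if "X \<in> P" "Y \<in> P" "X \<noteq> Y" "u \<in> X" "v \<in> Y" for u v X Y
  proof -
    have "{u, v} \<in> E" using edge[OF that(1,2,4,5)] that(3) by simp
    then have "c {u, v} < 2" using colors by blast
    then show ?thesis by linarith
  qed
  obtain A B D where ABD: "A \<in> P" "B \<in> P" "D \<in> P" "A \<noteq> B" "A \<noteq> D" "B \<noteq> D"
  proof -
    obtain Q where Q: "Q \<subseteq> P" "card Q = 3" using obtain_subset_with_card_n[OF assms(2)] by metis
    then obtain A B D where "Q = {A, B, D}" "A \<noteq> B" "B \<noteq> D" "A \<noteq> D"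
      by (auto simp: card_3_iff)
    then show thesis using that[of A B D] Q(1) by simp
  qed
  have two_in: "\<exists>u\<in>X. \<exists>v\<in>X. u \<noteq> v" if X: "X \<in> P" for X
  proof -
    obtain Q where "Q \<subseteq> X" "card Q = 2"
      using obtain_subset_with_card_n[of 2 X] assms(3) X by metis
    then show ?thesis unfolding card_2_iff by blast
  qed
  obtain a a' where a: "a \<in> A" "a' \<in> A" "a \<noteq> a'" using two_in[OF ABD(1)] by blast
  have zero: "\<exists>v\<in>X. c {a, v} = 0" if X: "X \<in> P" "A \<noteq> X" for X
  proof -
    obtain u v where uv: "u \<in> X" "v \<in> X" "u \<noteq> v" using two_in[OF X(1)] by blast
    have "c {u, a} \<noteq> c {v, a}"
      using split[OF X(1) ABD(1) X(2)[symmetric] uv a(1)] .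
    then show ?thesis
      using color[OF ABD(1) X a(1) uv(1)] color[OF ABD(1) X a(1) uv(2)] uv(1,2)
      by (metis insert_commute)
  qed
  obtain b d where bd: "b \<in> B" "c {a, b} = 0" "d \<in> D" "c {a, d} = 0"
    using zero[OF ABD(2,4)] zero[OF ABD(3,5)] by blast
  have "c {a', b} = 1" "c {a', d} = 1"
    using split[OF ABD(1,2,4) a bd(1)] color[OF ABD(1,2,4) a(2) bd(1)] bd(2)
      split[OF ABD(1,3,5) a bd(3)] color[OF ABD(1,3,5) a(2) bd(3)] bd(4) by simp_all
  moreover have "c {b, d} = 0 \<or> c {b, d} = 1"
    using color[OF ABD(2,3,6) bd(1,3)] .
  ultimately show False
    using nonmono[OF ABD a(1) bd(1,3)] nonmono[OF ABD a(2) bd(1,3)] bd(2,4) by blast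
qed

section \<open>The 3-rainbow index\<close>

theorem theorem6:
  fixes V :: "'a set" and E :: "'a set set" and P :: "'a set set" and r t :: nat
  assumes "r \<ge> 2" and "t \<ge> 3"
    and "complete_multipartite V E P"
    and "card P = t"
    and "\<forall>X\<in>P. card X = r"
  shows "rx3 V E = 3"
  unfolding rx3_def
proof (rule Least_equality)
  show "\<exists>c :: 'a set \<Rightarrow> nat. c ` E \<subseteq> {..<3} \<and>
     (\<forall>S. S \<subseteq> V \<and> card S = 3 \<longrightarrow> (\<exists>W F. rainbow_S_tree V E c S W F))"
    by (rule balanced_multipartite_three_colors[OF assms(3,4,5,1)]) (use assms(2) in simp)
next
  fix k
  assume "\<exists>c :: 'a set \<Rightarrow> nat. c ` E \<subseteq> {..<k} \<and>
     (\<forall>S. S \<subseteq> V \<and> card S = 3 \<longrightarrow> (\<exists>W F. rainbow_S_tree V E c S W F))"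
  then obtain c :: "'a set \<Rightarrow> nat" where c: "c ` E \<subseteq> {..<k}"
    and trees: "\<forall>S. S \<subseteq> V \<and> card S = 3 \<longrightarrow> (\<exists>W F. rainbow_S_tree V E c S W F)"
    by (elim exE conjE)
  show "3 \<le> k"
  proof (rule ccontr)
    assume "\<not> 3 \<le> k"
    then have "{..<k} \<subseteq> {..<2}" by auto
    then have two: "c ` E \<subseteq> {..<2}" using c by (rule subset_trans[rotated])
    show False
    proof (rule multipartite_two_colors_insufficient[OF assms(3) _ _ two])
      show "card P \<ge> 3" "\<forall>X\<in>P. card X \<ge> 2" using assms by simp_all
      show "\<exists>W F. rainbow_S_tree V E c S W F" if "S \<subseteq> V" "card S = 3" for S
        using trees that by simp
    qed
  qed
qed

end
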